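(* If $R$ is a semilocal sQQR-domain with treed spectrum, then $R$ is a QQR-domain.
   Context: Let $R$ be an integral domain with quotient field $K$. An overring of $R$ is a ring $T$ with $R \subseteq T \subseteq K$; it is an intersection of localizations of $R$ if it equals $\bigcap_{P \in \mathcal P} R_P$ for some set $\mathcal P$ of prime ideals of $R$. $R$ is an sQQR-domain if each simple overring $R[u]$ ($u \in K$) is an intersection of localizations of $R$, and a QQR-domain if each overring of $R$ is an intersection of localizations of $R$. Semilocal means having only finitely many maximal ideals (no Noetherian hypothesis). The spectrum of $R$ is treed if, for each prime ideal $Q$ of $R$, the prime ideals of $R$ contained in $Q$ are linearly ordered by inclusion. *)

theory Defs
  imports "HOL-Algebra.Ideal" "HOL-Algebra.Subrings" "HOL-Algebra.Finite_Extensions"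
begin

text \<open>
  Throughout, \<open>K\<close> is a ring record and \<open>R\<close> a subset of its carrier.  The set \<open>R\<close> as a ring in its
  own right is \<open>K\<lparr>carrier := R\<rparr>\<close>, so ideals of \<open>R\<close> are taken relative to that record,
  while fractions are formed in \<open>K\<close>.
\<close>

definition quotient_field :: "('a, 'b) ring_scheme \<Rightarrow> 'a set \<Rightarrow> bool" where
  "quotient_field K R \<longleftrightarrow>
     field K \<and> subdomain R K \<and>
     (\<forall>x \<in> carrier K. \<exists>a \<in> R. \<exists>b \<in> R - {\<zero>\<^bsub>K\<^esub>}. x = a \<otimes>\<^bsub>K\<^esub> inv\<^bsub>K\<^esub> b)"

definition prime_spectrum :: "('a, 'b) ring_scheme \<Rightarrow> 'a set \<Rightarrow> 'a set set" where
  "prime_spectrum K R = {P. primeideal P (K\<lparr>carrier := R\<rparr>)}"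

definition max_spectrum :: "('a, 'b) ring_scheme \<Rightarrow> 'a set \<Rightarrow> 'a set set" where
  "max_spectrum K R = {M. maximalideal M (K\<lparr>carrier := R\<rparr>)}"

definition localization_at :: "('a, 'b) ring_scheme \<Rightarrow> 'a set \<Rightarrow> 'a set \<Rightarrow> 'a set" where
  "localization_at K R P = {a \<otimes>\<^bsub>K\<^esub> inv\<^bsub>K\<^esub> s | a s. a \<in> R \<and> s \<in> R - P}"

definition overring :: "('a, 'b) ring_scheme \<Rightarrow> 'a set \<Rightarrow> 'a set \<Rightarrow> bool" where
  "overring K R T \<longleftrightarrow> subring T K \<and> R \<subseteq> T"

text \<open>
  Intersections are taken inside the quotient field, so that the empty intersection is \<open>K\<close>
  itself (which is also the localization of \<open>R\<close> at its zero ideal).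
\<close>

definition intersection_of_localizations ::
    "('a, 'b) ring_scheme \<Rightarrow> 'a set \<Rightarrow> 'a set \<Rightarrow> bool" where
  "intersection_of_localizations K R T \<longleftrightarrow>
     (\<exists>\<P> \<subseteq> prime_spectrum K R. T = carrier K \<inter> (\<Inter>P \<in> \<P>. localization_at K R P))"

text \<open>
  The library's \<open>ring.simple_extension K R u\<close> is the set of polynomial expressions in \<open>u\<close>
  with coefficients in \<open>R\<close> (generated by Horner steps), that is, the ring \<open>R[u]\<close>; it does not
  involve inverses even though \<open>K\<close> is a field.
\<close>

definition sQQR_domain :: "('a, 'b) ring_scheme \<Rightarrow> 'a set \<Rightarrow> bool" where
  "sQQR_domain K R \<longleftrightarrow>
     (\<forall>u \<in> carrier K. intersection_of_localizations K R (ring.simple_extension K R u))"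

definition QQR_domain :: "('a, 'b) ring_scheme \<Rightarrow> 'a set \<Rightarrow> bool" where
  "QQR_domain K R \<longleftrightarrow> (\<forall>T. overring K R T \<longrightarrow> intersection_of_localizations K R T)"

definition semilocal :: "('a, 'b) ring_scheme \<Rightarrow> 'a set \<Rightarrow> bool" where
  "semilocal K R \<longleftrightarrow> finite (max_spectrum K R)"

definition treed_spectrum :: "('a, 'b) ring_scheme \<Rightarrow> 'a set \<Rightarrow> bool" where
  "treed_spectrum K R \<longleftrightarrow>
     (\<forall>Q \<in> prime_spectrum K R. \<forall>P\<^sub>1 \<in> prime_spectrum K R. \<forall>P\<^sub>2 \<in> prime_spectrum K R.
        P\<^sub>1 \<subseteq> Q \<longrightarrow> P\<^sub>2 \<subseteq> Q \<longrightarrow> P\<^sub>1 \<subseteq> P\<^sub>2 \<or> P\<^sub>2 \<subseteq> P\<^sub>1)"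

end

theory Submission
  imports Defs
begin

text \<open>
  Let \<open>T\<close> be an overring and \<open>x \<in> K - T\<close>; we need a prime \<open>Q\<close> with \<open>T \<subseteq> R\<^sub>Q\<close> and \<open>x \<notin> R\<^sub>Q\<close>.
  Since the spectrum is treed and \<open>R\<close> is semilocal, there are only finitely many minimal primes
  \<open>Q\<close> with \<open>x \<notin> R\<^sub>Q\<close>, and they are pairwise comaximal.  If none of these \<open>R\<^sub>Q\<close> contained
  \<open>T\<close>, the Chinese remainder theorem would yield a single \<open>u \<in> T\<close> outside all of them.
  This contradicts the hypothesis on \<open>R[u]\<close>: as \<open>x \<notin> R[u]\<close>, some prime \<open>P\<close> has
  \<open>u \<in> R\<^sub>P\<close> and \<open>x \<notin> R\<^sub>P\<close>, and \<open>R\<^sub>P \<subseteq> R\<^sub>Q\<close> for a minimal \<open>Q \<subseteq> P\<close>.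
\<close>

section \<open>Comaximal ideals and the Chinese remainder theorem\<close>

text \<open>By induction: from \<open>a + b = 1\<close> for the earlier ideals and
  \<open>a' + b' = 1\<close> for the new one,
  \<open>1 = a + b (a' + b') = (a + b a') + b b'\<close>. The first summand stays in
  \<open>J\<close>, and \<open>b b'\<close> lies in the new ideal as well as in all earlier
  ones.\<close>

lemma (in cring) comaximal_finite_Inter:
  assumes "finite F" and "ideal J R"
    and "\<And>I. I \<in> F \<Longrightarrow> ideal I R" and "\<And>I. I \<in> F \<Longrightarrow> J <+> I = carrier R"
  shows "\<exists>a \<in> J. \<exists>b \<in> carrier R. (\<forall>I \<in> F. b \<in> I) \<and> a \<oplus> b = \<one>"
  using assms(1,3,4)
proof (induction F)
  case empty
  have "\<zero> \<in> J"
    using additive_subgroup.zero_closed[OF ideal.axioms(1)[OF assms(2)]] .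
  then show ?case by force
next
  case (insert I F)
  interpret J: ideal J R by fact
  interpret I: ideal I R using insert.prems(1) by blast
  obtain a b where ab: "a \<in> J" "b \<in> carrier R" "\<forall>I \<in> F. b \<in> I" "a \<oplus> b = \<one>"
    using insert by blast
  have "\<one> \<in> J <+> I" using insert.prems(2) by blast
  then obtain a' b' where ab': "a' \<in> J" "b' \<in> I" "a' \<oplus> b' = \<one>"
    unfolding set_add_def' by auto
  note carr = J.Icarr[OF ab(1)] J.Icarr[OF ab'(1)] ab(2) I.Icarr[OF ab'(2)]
  have "(a \<oplus> b \<otimes> a') \<oplus> b \<otimes> b' = a \<oplus> b \<otimes> (a' \<oplus> b')"
    using carr by algebra
  then have "(a \<oplus> b \<otimes> a') \<oplus> b \<otimes> b' = \<one>"
    using ab(4) ab'(3) carr by simp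
  moreover have "a \<oplus> b \<otimes> a' \<in> J"
    using ab ab' J.I_l_closed by simp
  moreover have "b \<otimes> b' \<in> I'" if "I' \<in> insert I F" for I'
  proof (cases "I' = I")
    case True then show ?thesis using I.I_l_closed carr ab' by simp
  next
    case False
    then have "ideal I' R" "b \<in> I'" using that insert.prems(1) ab(3) by auto
    then show ?thesis using ideal.I_r_closed carr by metis
  qed
  ultimately show ?case using carr by blast
qed

text \<open>Existence part of the Chinese remainder theorem for prescribed residues
  \<open>c I\<close>, with the congruence modulo \<open>I\<close> spelled out by an explicit
  \<open>q\<close>. The induction corrects a solution for \<open>F\<close> so that it also fits the
  new ideal.\<close>

lemma (in cring) chinese_remainder_finite:
  assumes "finite F" and "\<And>I. I \<in> F \<Longrightarrow> ideal I R"
    and "\<And>I J. I \<in> F \<Longrightarrow> J \<in> F \<Longrightarrow> I \<noteq> J \<Longrightarrow> I <+> J = carrier R"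
    and "\<And>I. I \<in> F \<Longrightarrow> c I \<in> carrier R"
  shows "\<exists>e \<in> carrier R. \<forall>I \<in> F. \<exists>q \<in> I. e = c I \<oplus> q"
  using assms
proof (induction F)
  case empty
  then show ?case by auto
next
  case (insert J F)
  interpret J: ideal J R using insert.prems(1) by blast
  have "\<exists>e \<in> carrier R. \<forall>I \<in> F. \<exists>q \<in> I. e = c I \<oplus> q"
    by (rule insert.IH) (simp_all add: insert.prems)
  then obtain e where e: "e \<in> carrier R" "\<forall>I \<in> F. \<exists>q \<in> I. e = c I \<oplus> q"
    by blast
  have "\<exists>a \<in> J. \<exists>b \<in> carrier R. (\<forall>I \<in> F. b \<in> I) \<and> a \<oplus> b = \<one>"
  proof (rule comaximal_finite_Inter[OF insert.hyps(1) J.is_ideal])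
    show "ideal I R" if "I \<in> F" for I using that insert.prems(1) by simp
    show "J <+> I = carrier R" if "I \<in> F" for I
      using that insert.hyps(2) insert.prems(2)[of J I] by auto
  qed
  then obtain a b where ab: "a \<in> J" "b \<in> carrier R" "\<forall>I \<in> F. b \<in> I" "a \<oplus> b = \<one>"
    by blast
  have a: "a \<in> carrier R" using J.Icarr[OF ab(1)] .
  have cJ: "c J \<in> carrier R" using insert.prems(3) by simp
  \<comment> \<open>Modulo \<open>J\<close> the element \<open>b = 1 - a\<close> is congruent to 1,
    so \<open>e'\<close> is congruent to \<open>c J\<close>. Modulo each \<open>I\<close> in
    \<open>F\<close> it vanishes, so the residue of \<open>e\<close> survives.\<close>
  define e' where "e' = e \<oplus> b \<otimes> (c J \<ominus> e)"
  have "\<exists>q \<in> I. e' = c I \<oplus> q" if "I \<in> insert J F" for I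
  proof (cases "I = J")
    case True
    have "e' = (a \<oplus> b) \<otimes> e \<oplus> b \<otimes> (c J \<ominus> e)"
      using ab(4) e(1) unfolding e'_def by simp
    also have "\<dots> = (a \<oplus> b) \<otimes> c J \<oplus> a \<otimes> (e \<ominus> c J)"
      using a ab(2) cJ e(1) by algebra
    finally have "e' = c J \<oplus> a \<otimes> (e \<ominus> c J)"
      using ab(4) cJ by simp
    moreover have "a \<otimes> (e \<ominus> c J) \<in> J"
      using J.I_r_closed ab(1) cJ e(1) by simp
    ultimately show ?thesis using True by blast
  next
    case False
    then have I: "I \<in> F" using that by simp
    interpret I: ideal I R using I insert.prems(1) by blast
    have cI: "c I \<in> carrier R" using insert.prems(3) I by simp
    obtain q where q: "q \<in> I" "e = c I \<oplus> q" using e(2) I by blast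
    have "e' = c I \<oplus> (q \<oplus> b \<otimes> (c J \<ominus> e))"
      unfolding e'_def using q cI cJ ab(2) e(1) I.Icarr[OF q(1)] by (simp add: a_assoc)
    moreover have "q \<oplus> b \<otimes> (c J \<ominus> e) \<in> I"
      using I.I_r_closed ab(3) I cJ e(1) q(1) by simp
    ultimately show ?thesis by blast
  qed
  moreover have "e' \<in> carrier R" unfolding e'_def using ab(2) cJ e(1) by simp
  ultimately show ?case by blast
qed

section \<open>Maximal ideals above an ideal, and intersections of chains of primes\<close>

text \<open>Zorn's lemma for the ideals that contain \<open>I\<close> and omit 1: omitting 1
  expresses properness in a form that passes to unions of chains.\<close>

lemma (in ring) ideal_le_maximalideal:
  assumes "ideal I R" and "I \<noteq> carrier R"
  shows "\<exists>M. maximalideal M R \<and> I \<subseteq> M"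
proof -
  define S where "S = {J. ideal J R \<and> \<one> \<notin> J \<and> I \<subseteq> J}"
  have one: "\<one> \<in> J \<longleftrightarrow> J = carrier R" if "ideal J R" for J
    using ideal.one_imp_carrier[OF that] by auto
  have "\<exists>M \<in> S. \<forall>J \<in> S. M \<subseteq> J \<longrightarrow> J = M"
  proof (rule subset_Zorn)
    fix C assume C: "subset.chain S C"
    show "\<exists>U \<in> S. \<forall>J \<in> C. J \<subseteq> U"
    proof (cases "C = {}")
      \<comment> \<open>The union of the empty chain is empty and hence no ideal, so
        \<open>I\<close> itself serves as upper bound here.\<close>
      case True
      then show ?thesis using assms one unfolding S_def by auto
    next
      case False
      have "subset.chain {J. ideal J R} C"
        using C unfolding pred_on.chain_def S_def by auto
      then have "ideal (\<Union>C) R"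
        using chain_Union_is_ideal[of C] False by simp
      moreover have "\<one> \<notin> \<Union>C" "I \<subseteq> \<Union>C"
        using C False unfolding pred_on.chain_def S_def by blast+
      ultimately show ?thesis unfolding S_def by auto
    qed
  qed
  then obtain M where M: "M \<in> S" "\<And>J. J \<in> S \<Longrightarrow> M \<subseteq> J \<Longrightarrow> J = M" by blast
  have "maximalideal M R"
  proof (rule maximalidealI)
    show "ideal M R" "carrier R \<noteq> M" using M(1) one unfolding S_def by auto
    fix J assume "ideal J R" "M \<subseteq> J" "J \<subseteq> carrier R"
    then show "J = M \<or> J = carrier R"
      using M(1) M(2)[of J] one[of J] unfolding S_def by blast
  qed
  then show ?thesis using M(1) unfolding S_def by blast
qed

text \<open>If \<open>a\<close> is missing from \<open>P\<close> and \<open>b\<close> from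
  \<open>Q\<close>, the smaller of the two primes misses both factors and hence their
  product.\<close>

lemma (in cring) chain_Inter_primeideal:
  assumes "C \<noteq> {}" and "\<And>P. P \<in> C \<Longrightarrow> primeideal P R"
    and "\<And>P Q. P \<in> C \<Longrightarrow> Q \<in> C \<Longrightarrow> P \<subseteq> Q \<or> Q \<subseteq> P"
  shows "primeideal (\<Inter>C) R"
proof (rule primeidealI)
  show "ideal (\<Inter>C) R"
    using i_Intersect[OF _ assms(1)] assms(2) primeideal.axioms(1) by blast
  show "cring R" by (rule is_cring)
  obtain P where P: "P \<in> C" using assms(1) by blast
  then have "P \<subseteq> carrier R" "P \<noteq> carrier R"
    using primeideal.I_notcarr[OF assms(2)] ideal.Icarr[OF primeideal.axioms(1)[OF assms(2)]]
    by auto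
  then show "carrier R \<noteq> \<Inter>C" using P by blast
next
  fix a b assume ab: "a \<in> carrier R" "b \<in> carrier R" "a \<otimes> b \<in> \<Inter>C"
  show "a \<in> \<Inter>C \<or> b \<in> \<Inter>C"
  proof (rule ccontr)
    assume "\<not> ?thesis"
    then obtain P Q where PQ: "P \<in> C" "Q \<in> C" "a \<notin> P" "b \<notin> Q" by blast
    then obtain L where "L \<in> C" "a \<notin> L" "b \<notin> L" using assms(3)[of P Q] by blast
    then show False using primeideal.I_prime[OF assms(2)] ab by blast
  qed
qed

section \<open>Primes and localizations of \<open>R\<close> inside the field
  \<open>K\<close>\<close>

locale subring_of_field = field K for K (structure) +
  fixes R
  assumes subring_R: "subring R K"
begin

lemmas R_closed = subringE[OF subring_R]

lemma R_carrier: "a \<in> R \<Longrightarrow> a \<in> carrier K"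
  using R_closed(1) by blast

lemma cring_R: "cring (K\<lparr>carrier := R\<rparr>)"
  using domain.axioms(1)[OF subring_is_domain[OF subring_R]] .

lemma prime_spectrumD:
  assumes "P \<in> prime_spectrum K R"
  shows "P \<subseteq> R" and "\<zero> \<in> P" and "\<one> \<notin> P"
    and "a \<in> P \<Longrightarrow> b \<in> P \<Longrightarrow> a \<oplus> b \<in> P" and "a \<in> P \<Longrightarrow> \<ominus> a \<in> P"
    and "a \<in> R \<Longrightarrow> b \<in> R \<Longrightarrow> a \<otimes> b \<in> P \<Longrightarrow> a \<in> P \<or> b \<in> P"
proof -
  interpret P: primeideal P "K\<lparr>carrier := R\<rparr>"
    using assms unfolding prime_spectrum_def by simp
  show "P \<subseteq> R" and "\<zero> \<in> P" using P.a_subset additive_subgroup.zero_closed[OF P.is_additive_subgroup] by simp_all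
  show "\<one> \<notin> P" using P.one_imp_carrier P.I_notcarr by auto
  show "a \<in> P \<Longrightarrow> b \<in> P \<Longrightarrow> a \<oplus> b \<in> P" using additive_subgroup.a_closed[OF P.is_additive_subgroup] by simp
  show "\<ominus> a \<in> P" if a: "a \<in> P"
  proof -
    \<comment> \<open>The negative is meant in \<open>K\<close>, whereas the ideal axioms refer to
      the record with carrier \<open>R\<close>. Writing it as the multiple of \<open>a\<close> by -1
      avoids comparing the two negations.\<close>
    have "\<ominus> \<one> \<otimes> a \<in> P" using P.I_l_closed[OF a] R_closed(3,5) by simp
    moreover have "a \<in> carrier K" using P.Icarr[OF a] R_carrier by simp
    ultimately show ?thesis by (simp add: l_minus)
  qed
  show "a \<in> R \<Longrightarrow> b \<in> R \<Longrightarrow> a \<otimes> b \<in> P \<Longrightarrow> a \<in> P \<or> b \<in> P" using P.I_prime by simp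
qed

lemma inv_closed: "s \<in> carrier K \<Longrightarrow> s \<noteq> \<zero> \<Longrightarrow> inv s \<in> carrier K"
  using field_Units Units_inv_closed by blast

lemma localization_at_subring:
  assumes P: "P \<in> prime_spectrum K R"
  shows "subring (localization_at K R P) K"
proof (rule subringI)
  note PD = prime_spectrumD[OF P]
  have s: "s \<in> carrier K" "s \<noteq> \<zero>" "inv s \<in> carrier K" "s \<otimes> inv s = \<one>" if "s \<in> R - P" for s
  proof -
    show "s \<in> carrier K" "s \<noteq> \<zero>" using that PD(2) R_carrier[of s] by auto
    then have "s \<in> Units K" using field_Units by blast
    then show "inv s \<in> carrier K" "s \<otimes> inv s = \<one>" by (fact Units_inv_closed, fact Units_r_inv)
  qed
  show "localization_at K R P \<subseteq> carrier K"
    unfolding localization_at_def using s R_carrier by auto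
  show "\<one> \<in> localization_at K R P"
    unfolding localization_at_def using PD(3) R_closed(3) by force
  fix h1 h2 assume h1: "h1 \<in> localization_at K R P"
  then obtain a s where 1: "a \<in> R" "s \<in> R - P" "h1 = a \<otimes> inv s"
    unfolding localization_at_def by auto
  have "\<ominus> h1 = \<ominus> a \<otimes> inv s" using 1 s R_carrier by (simp add: l_minus)
  then show "\<ominus> h1 \<in> localization_at K R P"
    unfolding localization_at_def using 1 R_closed(5) by blast
  assume h2: "h2 \<in> localization_at K R P"
  then obtain b t where 2: "b \<in> R" "t \<in> R - P" "h2 = b \<otimes> inv t"
    unfolding localization_at_def by auto
  note carr = R_carrier[OF 1(1)] R_carrier[OF 2(1)] s[OF 1(2)] s[OF 2(2)]
  have st: "s \<otimes> t \<in> R - P" using 1(2) 2(2) PD(6) R_closed(6) by blast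
  have inv_st: "inv (s \<otimes> t) = inv s \<otimes> inv t"
  proof (rule comm_inv_char)
    have "s \<otimes> t \<otimes> (inv s \<otimes> inv t) = (s \<otimes> inv s) \<otimes> (t \<otimes> inv t)"
      using carr(3,5,7,9) by algebra
    then show "s \<otimes> t \<otimes> (inv s \<otimes> inv t) = \<one>" using carr by simp
  qed (use carr in auto)
  have "h1 \<otimes> h2 = (a \<otimes> b) \<otimes> inv (s \<otimes> t)"
    unfolding 1(3) 2(3) inv_st using carr(1-3,5,7,9) by algebra
  then show "h1 \<otimes> h2 \<in> localization_at K R P"
    unfolding localization_at_def using st 1(1) 2(1) R_closed(6) by blast
  \<comment> \<open>Common denominator: the padding factors equal 1, but left unevaluated they make
    this a polynomial identity in which the inverses are just further ring elements.\<close>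
  have "a \<otimes> (t \<otimes> inv t) \<otimes> inv s \<oplus> b \<otimes> (s \<otimes> inv s) \<otimes> inv t
      = (a \<otimes> t \<oplus> b \<otimes> s) \<otimes> inv (s \<otimes> t)"
    unfolding inv_st using carr(1-3,5,7,9) by algebra
  then have "h1 \<oplus> h2 = (a \<otimes> t \<oplus> b \<otimes> s) \<otimes> inv (s \<otimes> t)"
    using 1(3) 2(3) carr by simp
  moreover have "a \<otimes> t \<oplus> b \<otimes> s \<in> R" using 1 2 R_closed(6,7) by blast
  ultimately show "h1 \<oplus> h2 \<in> localization_at K R P"
    unfolding localization_at_def using st by blast
qed

lemma inv_in_localization_at:
  assumes P: "P \<in> prime_spectrum K R" and s: "s \<in> R - P"
  shows "inv s \<in> localization_at K R P"
proof -
  have "s \<in> carrier K" "s \<noteq> \<zero>" using s prime_spectrumD(2)[OF P] R_carrier by auto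
  then have "inv s = \<one> \<otimes> inv s" using inv_closed by simp
  then show ?thesis unfolding localization_at_def using s R_closed(3) by blast
qed

lemma subset_localization_at:
  assumes P: "P \<in> prime_spectrum K R"
  shows "R \<subseteq> localization_at K R P"
proof
  fix a assume a: "a \<in> R"
  have "a = a \<otimes> inv \<one>" using R_carrier[OF a] by simp
  then show "a \<in> localization_at K R P"
    unfolding localization_at_def using a R_closed(3) prime_spectrumD(3)[OF P] by blast
qed

lemma localization_at_antimono: "Q \<subseteq> P \<Longrightarrow> localization_at K R P \<subseteq> localization_at K R Q"
  unfolding localization_at_def by blast

text \<open>An element of \<open>R\<close> outside \<open>P\<close> is a unit of the localization at
  \<open>P\<close>.\<close>

lemma localization_at_cancel:
  assumes P: "P \<in> prime_spectrum K R" and s: "s \<in> R - P" and v: "v \<in> carrier K"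
    and sv: "s \<otimes> v \<in> localization_at K R P"
  shows "v \<in> localization_at K R P"
proof -
  have s': "s \<in> carrier K" "s \<noteq> \<zero>" using s prime_spectrumD(2)[OF P] R_carrier by auto
  then have "inv s \<in> carrier K" "inv s \<otimes> s = \<one>" using field_Units by auto
  then have "inv s \<otimes> (s \<otimes> v) = v" using s' v by (simp flip: m_assoc)
  then show ?thesis
    using subringE(6)[OF localization_at_subring[OF P] inv_in_localization_at[OF P s] sv] by simp
qed

lemma localization_at_add_cancel:
  assumes P: "P \<in> prime_spectrum K R" and u: "u \<in> carrier K" and w: "w \<in> localization_at K R P"
    and uw: "u \<oplus> w \<in> localization_at K R P"
  shows "u \<in> localization_at K R P"
proof -
  note L = subringE[OF localization_at_subring[OF P]]
  have "w \<in> carrier K" using w L(1) by blast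
  then have "u = (u \<oplus> w) \<oplus> \<ominus> w" using u by algebra
  then show ?thesis using L(5)[OF w] L(7) uw by metis
qed

section \<open>Elements of an overring that avoid finitely many localizations\<close>

text \<open>Otherwise \<open>1 = (1 + q) - q\<close> would lie in \<open>Q\<close>. The lemma turns
  every element of the coset \<open>1 + Q\<close> into a factor that can be cancelled in the
  localization at \<open>Q\<close>.\<close>

lemma one_add_notin_prime:
  assumes Q: "Q \<in> prime_spectrum K R" and q: "q \<in> Q"
  shows "\<one> \<oplus> q \<in> R - Q"
proof -
  note QD = prime_spectrumD[OF Q]
  have qR: "q \<in> R" using q QD(1) by blast
  have "(\<one> \<oplus> q) \<oplus> \<ominus> q = \<one>" using R_carrier[OF qR] by algebra
  then have "\<one> \<oplus> q \<notin> Q" using QD(3) QD(4)[of "\<one> \<oplus> q"] QD(5)[OF q] by metis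
  then show ?thesis using R_closed(3,7) qR by simp
qed

text \<open>All \<open>e \<in> R\<close> with \<open>u + e v \<in> R\<^sub>Q\<close> lie in one coset \<open>d + Q\<close>: otherwise \<open>v\<close>, and then \<open>u\<close>,
  would be in \<open>R\<^sub>Q\<close>.  Hence the coset of \<open>c = d + 1\<close> is free of such \<open>e\<close>.\<close>

lemma coset_avoiding_localization:
  assumes Q: "Q \<in> prime_spectrum K R" and u: "u \<in> carrier K" and v: "v \<in> carrier K"
    and u_notin: "u \<notin> localization_at K R Q"
  shows "\<exists>c \<in> R. \<forall>q \<in> Q. u \<oplus> (c \<oplus> q) \<otimes> v \<notin> localization_at K R Q"
proof (cases "\<exists>d \<in> R. u \<oplus> d \<otimes> v \<in> localization_at K R Q")
  case True
  note L = subringE[OF localization_at_subring[OF Q]] and QD = prime_spectrumD[OF Q]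
  obtain d where d: "d \<in> R" "u \<oplus> d \<otimes> v \<in> localization_at K R Q" using True by blast
  have "u \<oplus> (d \<oplus> \<one> \<oplus> q) \<otimes> v \<notin> localization_at K R Q" if q: "q \<in> Q" for q
  proof
    assume *: "u \<oplus> (d \<oplus> \<one> \<oplus> q) \<otimes> v \<in> localization_at K R Q"
    have qR: "q \<in> R" using q QD(1) by blast
    note carr = R_carrier[OF qR] R_carrier[OF d(1)] u v
    have "u \<oplus> (d \<oplus> \<one> \<oplus> q) \<otimes> v = (\<one> \<oplus> q) \<otimes> v \<oplus> (u \<oplus> d \<otimes> v)" using carr by algebra
    then have "(\<one> \<oplus> q) \<otimes> v \<in> localization_at K R Q"
      using localization_at_add_cancel[OF Q _ d(2)] * carr by simp
    then have "v \<in> localization_at K R Q"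
      using localization_at_cancel[OF Q one_add_notin_prime[OF Q q] v] by blast
    then have "d \<otimes> v \<in> localization_at K R Q"
      using L(6) subset_localization_at[OF Q] d(1) by blast
    then show False using localization_at_add_cancel[OF Q u _ d(2)] u_notin by blast
  qed
  then show ?thesis using d(1) R_closed(3,7) by blast
next
  \<comment> \<open>No \<open>e\<close> in \<open>R\<close> brings \<open>u + e v\<close> into the
    localization, so every coset of \<open>Q\<close> is free.\<close>
  case False
  then show ?thesis using R_closed(2,7) prime_spectrumD(1)[OF Q] by blast
qed

text \<open>Induction on \<open>F\<close>: \<open>u\<close> in \<open>T\<close> avoids the earlier
  localizations and \<open>v\<close> in \<open>T\<close> avoids the new one. A combination
  \<open>u + e v\<close> with \<open>e\<close> in \<open>R\<close> stays in \<open>T\<close>; for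
  each prime a whole coset of values \<open>e\<close> is harmless, and comaximality allows all these
  cosets to be met at once.\<close>

lemma overring_avoids_localizations:
  assumes T: "subring T K" "R \<subseteq> T" and "finite F"
    and "F \<subseteq> prime_spectrum K R"
    and "\<And>P Q. P \<in> F \<Longrightarrow> Q \<in> F \<Longrightarrow> P \<noteq> Q \<Longrightarrow> P <+>\<^bsub>K\<lparr>carrier := R\<rparr>\<^esub> Q = R"
    and "\<And>Q. Q \<in> F \<Longrightarrow> \<not> T \<subseteq> localization_at K R Q"
  shows "\<exists>u \<in> T. \<forall>Q \<in> F. u \<notin> localization_at K R Q"
  using assms(3-6)
proof (induction F)
  case empty
  then show ?case using subringE(2)[OF T(1)] by blast
next
  case (insert Q F)
  interpret A: cring "K\<lparr>carrier := R\<rparr>" by (rule cring_R)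
  note TD = subringE[OF T(1)]
  obtain u where u: "u \<in> T" "\<forall>P \<in> F. u \<notin> localization_at K R P" using insert by auto
  obtain v where v: "v \<in> T" "v \<notin> localization_at K R Q" using insert.prems(3)[of Q] by auto
  have carr: "u \<in> carrier K" "v \<in> carrier K" using u(1) v(1) TD(1) by auto
  have Q: "Q \<in> prime_spectrum K R" using insert.prems(1) by simp
  show ?case
  proof (cases "u \<in> localization_at K R Q")
    case False
    then show ?thesis using u by blast
  next
    case True
    have "\<exists>c \<in> R. \<forall>q \<in> P. u \<oplus> (c \<oplus> q) \<otimes> v \<notin> localization_at K R P" if "P \<in> insert Q F" for P
    proof (cases "P = Q")
      case False
      then show ?thesis using coset_avoiding_localization[OF _ carr] that u(2) insert.prems(1) by auto
    next
      case P: True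
      \<comment> \<open>At the new prime \<open>u\<close> lies in the localization and
        \<open>v\<close> does not, so any multiplier outside \<open>Q\<close> is harmless; the coset
        of 1 is chosen.\<close>
      have "u \<oplus> (\<one> \<oplus> q) \<otimes> v \<notin> localization_at K R Q" if q: "q \<in> Q" for q
      proof
        assume *: "u \<oplus> (\<one> \<oplus> q) \<otimes> v \<in> localization_at K R Q"
        have qK: "q \<in> carrier K" using q prime_spectrumD(1)[OF Q] R_carrier by blast
        have "(\<one> \<oplus> q) \<otimes> v \<in> localization_at K R Q"
          using localization_at_add_cancel[OF Q _ True] * carr qK by (simp add: a_comm)
        then show False
          using localization_at_cancel[OF Q one_add_notin_prime[OF Q q] carr(2)] v(2) by blast
      qed
      then show ?thesis using P R_closed(3) by blast
    qed
    then obtain c where c: "\<And>P. P \<in> insert Q F \<Longrightarrow> c P \<in> R"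
      "\<And>P q. P \<in> insert Q F \<Longrightarrow> q \<in> P \<Longrightarrow> u \<oplus> (c P \<oplus> q) \<otimes> v \<notin> localization_at K R P"
      by metis
    have "\<exists>e \<in> carrier (K\<lparr>carrier := R\<rparr>). \<forall>P \<in> insert Q F. \<exists>q \<in> P. e = c P \<oplus>\<^bsub>K\<lparr>carrier := R\<rparr>\<^esub> q"
    \<comment> \<open>The remainder theorem yields one \<open>e\<close> in the harmless coset
      \<open>c P + P\<close> of every prime \<open>P\<close> concerned.\<close>
    proof (rule A.chinese_remainder_finite)
      show "finite (insert Q F)" using insert.hyps(1) by simp
      show "ideal P (K\<lparr>carrier := R\<rparr>)" if "P \<in> insert Q F" for P
        using insert.prems(1) that primeideal.axioms(1) unfolding prime_spectrum_def by blast
    qed (use insert.prems(2) c(1) in auto)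
    then obtain e where e: "e \<in> R" "\<forall>P \<in> insert Q F. \<exists>q \<in> P. e = c P \<oplus> q" by auto
    have "u \<oplus> e \<otimes> v \<in> T" using u(1) v(1) e(1) T(2) TD(6,7) by blast
    moreover have "\<forall>P \<in> insert Q F. u \<oplus> e \<otimes> v \<notin> localization_at K R P" using e(2) c(2) by metis
    ultimately show ?thesis by blast
  qed
qed

section \<open>Comaximal primes and the minimal primes excluding \<open>x\<close>\<close>

text \<open>A proper sum would lie in some maximal ideal, which would then contain both summands
  because each of them contains 0.\<close>

lemma comaximal_if_no_common_maximal:
  assumes P: "P \<in> prime_spectrum K R" and Q: "Q \<in> prime_spectrum K R"
    and no_max: "\<And>M. M \<in> max_spectrum K R \<Longrightarrow> P \<subseteq> M \<Longrightarrow> \<not> Q \<subseteq> M"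
  shows "P <+>\<^bsub>K\<lparr>carrier := R\<rparr>\<^esub> Q = R"
proof (rule ccontr)
  assume neq: "P <+>\<^bsub>K\<lparr>carrier := R\<rparr>\<^esub> Q \<noteq> R"
  interpret A: cring "K\<lparr>carrier := R\<rparr>" by (rule cring_R)
  have "ideal P (K\<lparr>carrier := R\<rparr>)" "ideal Q (K\<lparr>carrier := R\<rparr>)"
    using P Q primeideal.axioms(1) unfolding prime_spectrum_def by blast+
  then have "ideal (P <+>\<^bsub>K\<lparr>carrier := R\<rparr>\<^esub> Q) (K\<lparr>carrier := R\<rparr>)" by (rule A.add_ideals)
  then obtain M where M: "maximalideal M (K\<lparr>carrier := R\<rparr>)" "P <+>\<^bsub>K\<lparr>carrier := R\<rparr>\<^esub> Q \<subseteq> M"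
    using A.ideal_le_maximalideal neq by auto
  have sum: "p \<oplus> q \<in> M" if "p \<in> P" "q \<in> Q" for p q
    using M(2) that unfolding set_add_def' by auto
  have "p \<in> M" if "p \<in> P" for p
    using sum[OF that prime_spectrumD(2)[OF Q]] R_carrier prime_spectrumD(1)[OF P] that by auto
  moreover have "q \<in> M" if "q \<in> Q" for q
    using sum[OF prime_spectrumD(2)[OF P] that] R_carrier prime_spectrumD(1)[OF Q] that by auto
  ultimately show False using no_max[of M] M(1) unfolding max_spectrum_def by auto
qed

lemma prime_le_maximal:
  assumes "P \<in> prime_spectrum K R"
  shows "\<exists>M \<in> max_spectrum K R. P \<subseteq> M"
proof -
  interpret A: cring "K\<lparr>carrier := R\<rparr>" by (rule cring_R)
  have "ideal P (K\<lparr>carrier := R\<rparr>)" "P \<noteq> carrier (K\<lparr>carrier := R\<rparr>)"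
    using assms primeideal.axioms(1) primeideal.I_notcarr unfolding prime_spectrum_def by blast+
  then show ?thesis using A.ideal_le_maximalideal[of P] unfolding max_spectrum_def by auto
qed

lemma max_spectrum_subset_prime_spectrum: "max_spectrum K R \<subseteq> prime_spectrum K R"
  using cring.maximalideal_prime[OF cring_R] unfolding max_spectrum_def prime_spectrum_def by auto

text \<open>The members of \<open>F\<close> are the smallest primes \<open>P\<close> below the various maximal ideals with
  \<open>x \<notin> R\<^sub>P\<close>; below a fixed maximal ideal such primes form a chain, whose intersection
  is again such a prime.\<close>

lemma minimal_excluding_primes:
  assumes "semilocal K R" and treed: "treed_spectrum K R"
  shows "\<exists>F \<subseteq> {P \<in> prime_spectrum K R. x \<notin> localization_at K R P}. finite F \<and>
    (\<forall>P \<in> F. \<forall>Q \<in> F. P \<noteq> Q \<longrightarrow> P <+>\<^bsub>K\<lparr>carrier := R\<rparr>\<^esub> Q = R) \<and>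
    (\<forall>P \<in> prime_spectrum K R. x \<notin> localization_at K R P \<longrightarrow> (\<exists>Q \<in> F. Q \<subseteq> P))"
proof -
  define C where "C M = {P \<in> prime_spectrum K R. x \<notin> localization_at K R P \<and> P \<subseteq> M}" for M
  define F where "F = (\<lambda>M. \<Inter>(C M)) ` {M \<in> max_spectrum K R. C M \<noteq> {}}"
  have Inter_in: "\<Inter>(C M) \<in> C M" if M: "M \<in> max_spectrum K R" "C M \<noteq> {}" for M
  proof -
    have "primeideal (\<Inter>(C M)) (K\<lparr>carrier := R\<rparr>)"
    proof (rule cring.chain_Inter_primeideal[OF cring_R M(2)])
      fix P Q assume "P \<in> C M" "Q \<in> C M"
      then show "P \<subseteq> Q \<or> Q \<subseteq> P"
        using treed M(1) max_spectrum_subset_prime_spectrum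
        unfolding C_def treed_spectrum_def by blast
    qed (simp add: C_def prime_spectrum_def)
    \<comment> \<open>A denominator outside the intersection is already outside some
      \<open>P\<close> in \<open>C M\<close>, which would put \<open>x\<close> into the localization
      at that \<open>P\<close>.\<close>
    moreover have "x \<notin> localization_at K R (\<Inter>(C M))"
    proof
      assume "x \<in> localization_at K R (\<Inter>(C M))"
      then obtain a s where as: "a \<in> R" "s \<in> R - \<Inter>(C M)" "x = a \<otimes> inv s"
        unfolding localization_at_def by blast
      then obtain P where "P \<in> C M" "s \<notin> P" by blast
      then show False using as unfolding C_def localization_at_def by blast
    qed
    ultimately show ?thesis using M(2) unfolding C_def prime_spectrum_def by blast
  qed
  have min: "Q \<subseteq> P" if Q: "Q \<in> F" and P: "P \<in> prime_spectrum K R" "x \<notin> localization_at K R P" "P \<subseteq> Q" for P Q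
  proof -
    obtain M where M: "M \<in> max_spectrum K R" "C M \<noteq> {}" "Q = \<Inter>(C M)"
      using Q unfolding F_def by blast
    then have "P \<in> C M" using P Inter_in[OF M(1,2)] unfolding C_def by blast
    then show ?thesis using M(3) by blast
  qed
  have sub: "F \<subseteq> {P \<in> prime_spectrum K R. x \<notin> localization_at K R P}"
    using Inter_in unfolding F_def C_def by blast
  moreover have "finite F" using assms(1) unfolding F_def semilocal_def by simp
  moreover have "P <+>\<^bsub>K\<lparr>carrier := R\<rparr>\<^esub> Q = R" if PQ: "P \<in> F" "Q \<in> F" "P \<noteq> Q" for P Q
  proof (rule comaximal_if_no_common_maximal)
    show P: "P \<in> prime_spectrum K R" and Q: "Q \<in> prime_spectrum K R" using sub PQ by auto
    fix M assume M: "M \<in> max_spectrum K R" "P \<subseteq> M"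
    \<comment> \<open>Below a common maximal ideal the two primes would be comparable by treedness,
      and \<open>min\<close> would make them equal.\<close>
    show "\<not> Q \<subseteq> M"
    proof
      assume "Q \<subseteq> M"
      then have "P \<subseteq> Q \<or> Q \<subseteq> P"
        using treed M P Q max_spectrum_subset_prime_spectrum unfolding treed_spectrum_def by blast
      then show False using min PQ sub by blast
    qed
  qed
  moreover have "\<exists>Q \<in> F. Q \<subseteq> P" if P: "P \<in> prime_spectrum K R" "x \<notin> localization_at K R P" for P
  proof -
    obtain M where M: "M \<in> max_spectrum K R" "P \<subseteq> M" using prime_le_maximal P(1) by blast
    then have "P \<in> C M" using P unfolding C_def by simp
    then show ?thesis using M(1) unfolding F_def by blast
  qed
  ultimately show ?thesis by (intro exI[of _ F] conjI ballI impI)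
qed

section \<open>Separating an overring from an element outside it\<close>

lemma excluding_prime:
  assumes "semilocal K R" and sQQR: "sQQR_domain K R" and "treed_spectrum K R"
    and T: "overring K R T" and x: "x \<in> carrier K" "x \<notin> T"
  shows "\<exists>P \<in> prime_spectrum K R. T \<subseteq> localization_at K R P \<and> x \<notin> localization_at K R P"
proof (rule ccontr)
  assume none: "\<not> ?thesis"
  have TD: "subring T K" "R \<subseteq> T" using T unfolding overring_def by auto
  obtain F where F: "F \<subseteq> {P \<in> prime_spectrum K R. x \<notin> localization_at K R P}" "finite F"
    "\<forall>P \<in> F. \<forall>Q \<in> F. P \<noteq> Q \<longrightarrow> P <+>\<^bsub>K\<lparr>carrier := R\<rparr>\<^esub> Q = R"
    "\<forall>P \<in> prime_spectrum K R. x \<notin> localization_at K R P \<longrightarrow> (\<exists>Q \<in> F. Q \<subseteq> P)"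
    using minimal_excluding_primes[OF assms(1,3), of x] by (elim exE conjE) (rule that)
  have "\<exists>u \<in> T. \<forall>Q \<in> F. u \<notin> localization_at K R Q"
  proof (rule overring_avoids_localizations[OF TD F(2)])
    show "F \<subseteq> prime_spectrum K R" using F(1) by blast
    show "P <+>\<^bsub>K\<lparr>carrier := R\<rparr>\<^esub> Q = R" if "P \<in> F" "Q \<in> F" "P \<noteq> Q" for P Q
      using F(3) that by simp
    show "\<not> T \<subseteq> localization_at K R Q" if "Q \<in> F" for Q
    proof -
      have "Q \<in> prime_spectrum K R" "x \<notin> localization_at K R Q" using F(1) that by blast+
      then show ?thesis using none by blast
    qed
  qed
  then obtain u where u: "u \<in> T" "\<forall>Q \<in> F. u \<notin> localization_at K R Q" by blast
  have uK: "u \<in> carrier K" using u(1) subringE(1)[OF TD(1)] by blast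
  then have "intersection_of_localizations K R (simple_extension R u)"
    using sQQR unfolding sQQR_domain_def by simp
  then obtain \<P> where \<P>: "\<P> \<subseteq> prime_spectrum K R"
    "simple_extension R u = carrier K \<inter> (\<Inter>P \<in> \<P>. localization_at K R P)"
    unfolding intersection_of_localizations_def by (elim exE conjE) (rule that)
  \<comment> \<open>Since \<open>R\<close> and \<open>u\<close> lie in \<open>T\<close>, so does
    \<open>R[u]\<close>. Hence one of the localizations that cut out \<open>R[u]\<close> must omit
    \<open>x\<close>.\<close>
  have "x \<notin> simple_extension R u"
    using simple_extension_subring_incl[OF TD u(1)] x(2) by blast
  then obtain P where P: "P \<in> \<P>" "x \<notin> localization_at K R P" using \<P>(2) x(1) by blast
  then obtain Q where Q: "Q \<in> F" "Q \<subseteq> P" using F(4) \<P>(1) by blast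
  have "u \<in> localization_at K R P"
    using simple_extension_mem[OF subring_R uK] \<P>(2) P(1) by blast
  then show False using u(2) Q localization_at_antimono by blast
qed

end

theorem theorem2p19:
  fixes K :: "('a, 'b) ring_scheme" and R :: "'a set"
  assumes "quotient_field K R"
    and "semilocal K R"
    and "sQQR_domain K R"
    and "treed_spectrum K R"
  shows "QQR_domain K R"
  unfolding QQR_domain_def
proof (intro allI impI)
  fix T assume T: "overring K R T"
  have "field K" and "subdomain R K"
    using assms(1) unfolding quotient_field_def by simp_all
  then interpret subring_of_field K R
    using subcring.axioms(1)[OF subdomain.axioms(1)]
    by (intro subring_of_field.intro subring_of_field_axioms.intro)
  have "T \<subseteq> carrier K" using T subringE(1) unfolding overring_def by blast
  \<comment> \<open>All primes whose localization contains \<open>T\<close> are used, which gives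
    one inclusion at once; \<open>excluding_prime\<close> removes every \<open>x\<close> outside
    \<open>T\<close> and gives the other.\<close>
  then have "T = carrier K \<inter>
      (\<Inter>P \<in> {P \<in> prime_spectrum K R. T \<subseteq> localization_at K R P}. localization_at K R P)"
    using excluding_prime[OF assms(2-4) T] by blast
  then show "intersection_of_localizations K R T"
    unfolding intersection_of_localizations_def by blast
qed

end
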